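(* Let $V$ be a finite set, $f\colon 2^V\to\mathbb{R}_{\ge 0}$ a symmetric submodular function with $f(\emptyset)=0$, and $\mathcal{M}$ a matroid on $V$ of rank $k\ge 1$. Let $\mathcal{P}$ be the partition returned by the Gomory-Hu tree algorithm on input $(f,\mathcal{M})$ (described in the context). Then $\mathcal{P}$ is a feasible solution of the Submodular Matroid-constrained Partitioning problem for $(f,\mathcal{M})$, and $\sum_{X\in\mathcal{P}} f(X)\le (2-2/k)\cdot \mathrm{OPT}$, where $\mathrm{OPT}$ is the minimum of $\sum_{i=1}^k f(V_i)$ over all feasible partitions. That is, the Gomory-Hu tree algorithm is a $(2-2/k)$-approximation for this problem restricted to symmetric submodular functions.
   Context: A set function $f\colon 2^V\to\mathbb{R}$ is submodular if $f(A)+f(B)\ge f(A\cup B)+f(A\cap B)$ for all $A,B\subseteq V$, and symmetric if $f(A)=f(V\setminus A)$ for all $A\subseteq V$. The matroid is accessed through an independence oracle and $f$ through a value oracle. Submodular Matroid-constrained Partitioning: given $f$ and a rank-$k$ matroid $\mathcal{M}$ on $V$ with family of bases $\mathcal{B}$, a partition $\{V_1,\dots,V_k\}$ of $V$ is feasible if there exists $B\in\mathcal{B}$ with $|B\cap V_i|=1$ for all $i\in[k]$; the goal is to minimize $\sum_{i=1}^k f(V_i)$ over feasible partitions. A Gomory-Hu tree of a symmetric submodular $f$ is a tree $H=(V,E)$ with weights $w_H\in\mathbb{R}^E_{\ge 0}$ such that for all distinct $s,t\in V$, the minimum $w_H$-weight of an edge on the $s$–$t$ path $P_{s,t}$ in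 $H$ equals $\min\{f(S): s\in S\subseteq V\setminus\{t\}\}$, and the two components of $H$ minus a minimum-weight edge of $P_{s,t}$ are the two sides of a minimizer of this cut problem. Given a tree $H=(V,E)$ and the matroid $\mathcal{M}=(V,\mathcal{I})$, define $\mathcal{I}'\subseteq 2^E$ as the family of edge sets $X'\subseteq E$ such that the connected components $V_1,\dots,V_{|X'|+1}$ of $H-X'$ admit elements $v_i\in V_i$ with $\{v_1,\dots,v_{|X'|+1}\}\in\mathcal{I}$. Gomory-Hu tree algorithm: compute a Gomory-Hu tree $(H,w_H)$ of $f$; set $C=\emptyset$; while $|C|<k-1$, pick $e\in E\setminus C$ with $C\cup\{e\}\in\mathcal{I}'$ minimizing $w_H(e)$, and set $C\gets C\cup\{e\}$; return the connected components of $(V,E\setminus C)$. *)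

theory Defs
  imports Complex_Main "HOL-Library.Disjoint_Sets"
begin

definition submodular_on :: "'a set \<Rightarrow> ('a set \<Rightarrow> real) \<Rightarrow> bool" where
  "submodular_on V f \<longleftrightarrow>
     (\<forall>A B. A \<subseteq> V \<longrightarrow> B \<subseteq> V \<longrightarrow> f A + f B \<ge> f (A \<union> B) + f (A \<inter> B))"

definition symmetric_on :: "'a set \<Rightarrow> ('a set \<Rightarrow> real) \<Rightarrow> bool" where
  "symmetric_on V f \<longleftrightarrow> (\<forall>A. A \<subseteq> V \<longrightarrow> f A = f (V - A))"

locale matroid =
  fixes V :: "'a set" and \<I> :: "'a set set"
  assumes finite_ground: "finite V"
    and indep_subset_ground: "X \<in> \<I> \<Longrightarrow> X \<subseteq> V"
    and empty_indep: "{} \<in> \<I>"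
    and indep_mono: "Y \<in> \<I> \<Longrightarrow> X \<subseteq> Y \<Longrightarrow> X \<in> \<I>"
    and augment: "X \<in> \<I> \<Longrightarrow> Y \<in> \<I> \<Longrightarrow> card X < card Y \<Longrightarrow> \<exists>y\<in>Y - X. insert y X \<in> \<I>"

definition bases :: "'a set set \<Rightarrow> 'a set set" where
  "bases \<I> = {B \<in> \<I>. \<forall>X\<in>\<I>. B \<subseteq> X \<longrightarrow> X = B}"

definition matroid_rank :: "'a set set \<Rightarrow> nat" where
  "matroid_rank \<I> = Max (card ` \<I>)"

text \<open>\<^const>\<open>partition_on\<close> requires non-empty parts; this is no restriction here, since every
  part has to meet the base.\<close>

definition feasible :: "'a set \<Rightarrow> 'a set set \<Rightarrow> 'a set set \<Rightarrow> bool" where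
  "feasible V \<I> P \<longleftrightarrow>
     partition_on V P \<and> card P = matroid_rank \<I> \<and>
     (\<exists>B\<in>bases \<I>. \<forall>X\<in>P. card (B \<inter> X) = 1)"

definition opt_value :: "'a set \<Rightarrow> ('a set \<Rightarrow> real) \<Rightarrow> 'a set set \<Rightarrow> real" where
  "opt_value V f \<I> = Min {(\<Sum>X\<in>P. f X) | P. feasible V \<I> P}"

definition simple_graph :: "'a set \<Rightarrow> 'a set set \<Rightarrow> bool" where
  "simple_graph V E \<longleftrightarrow> (\<forall>e\<in>E. e \<subseteq> V \<and> card e = 2)"

definition reachable :: "'a set set \<Rightarrow> ('a \<times> 'a) set" where
  "reachable E = {(u, v). {u, v} \<in> E}\<^sup>*"

definition components :: "'a set \<Rightarrow> 'a set set \<Rightarrow> 'a set set" where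
  "components V E = {{v \<in> V. (u, v) \<in> reachable E} | u. u \<in> V}"

definition cycle :: "'a set set \<Rightarrow> 'a list \<Rightarrow> bool" where
  "cycle E c \<longleftrightarrow> length c \<ge> 3 \<and> distinct c \<and>
     successively (\<lambda>u v. {u, v} \<in> E) c \<and> {last c, hd c} \<in> E"

definition tree :: "'a set \<Rightarrow> 'a set set \<Rightarrow> bool" where
  "tree V E \<longleftrightarrow> simple_graph V E \<and> V \<noteq> {} \<and>
     (\<forall>u\<in>V. \<forall>v\<in>V. (u, v) \<in> reachable E) \<and> (\<nexists>c. cycle E c)"

definition path :: "'a set set \<Rightarrow> 'a \<Rightarrow> 'a \<Rightarrow> 'a list \<Rightarrow> bool" where
  "path E s t p \<longleftrightarrow> p \<noteq> [] \<and> hd p = s \<and> last p = t \<and> distinct p \<and>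
     successively (\<lambda>u v. {u, v} \<in> E) p"

definition path_edges :: "'a list \<Rightarrow> 'a set set" where
  "path_edges p = {{u, v} | u v. (u, v) \<in> set (zip p (tl p))}"

definition cuts :: "'a set \<Rightarrow> 'a \<Rightarrow> 'a \<Rightarrow> 'a set set" where
  "cuts V s t = {S. s \<in> S \<and> S \<subseteq> V - {t}}"

text \<open>Quantifying over all paths \<open>p\<close> from \<open>s\<close> to \<open>t\<close> refers to the one path that exists in a
  tree.\<close>

definition gomory_hu_tree ::
    "'a set \<Rightarrow> ('a set \<Rightarrow> real) \<Rightarrow> 'a set set \<Rightarrow> ('a set \<Rightarrow> real) \<Rightarrow> bool" where
  "gomory_hu_tree V f E w \<longleftrightarrow>
     tree V E \<and> (\<forall>e\<in>E. w e \<ge> 0) \<and>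
     (\<forall>s\<in>V. \<forall>t\<in>V. \<forall>p. s \<noteq> t \<longrightarrow> path E s t p \<longrightarrow>
        Min (w ` path_edges p) = Min (f ` cuts V s t) \<and>
        (\<forall>e\<in>path_edges p. w e = Min (w ` path_edges p) \<longrightarrow>
           (\<exists>S\<in>cuts V s t. f S = Min (f ` cuts V s t) \<and>
              components V (E - {e}) = {S, V - S})))"

text \<open>The family \<open>\<I>'\<close>; the function \<open>v\<close> picks a representative of each component.\<close>

definition edge_indep :: "'a set \<Rightarrow> 'a set set \<Rightarrow> 'a set set \<Rightarrow> 'a set set set" where
  "edge_indep V \<I> E = {X. X \<subseteq> E \<and>
     (\<exists>v. (\<forall>D\<in>components V (E - X). v D \<in> D) \<and> v ` components V (E - X) \<in> \<I>)}"

text \<open>A relation rather than a function because ties are broken arbitrarily.\<close>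

definition gh_step ::
    "'a set \<Rightarrow> 'a set set \<Rightarrow> 'a set set \<Rightarrow> ('a set \<Rightarrow> real) \<Rightarrow>
     'a set set \<Rightarrow> 'a set set \<Rightarrow> bool" where
  "gh_step V \<I> E w C C' \<longleftrightarrow> card C < matroid_rank \<I> - 1 \<and>
     (\<exists>e\<in>E - C. insert e C \<in> edge_indep V \<I> E \<and>
        (\<forall>e'\<in>E - C. insert e' C \<in> edge_indep V \<I> E \<longrightarrow> w e \<le> w e') \<and>
        C' = insert e C)"

definition gh_reaches ::
    "'a set \<Rightarrow> 'a set set \<Rightarrow> 'a set set \<Rightarrow> ('a set \<Rightarrow> real) \<Rightarrow> 'a set set \<Rightarrow> bool" where
  "gh_reaches V \<I> E w C \<longleftrightarrow> (gh_step V \<I> E w)\<^sup>*\<^sup>* {} C"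

definition gh_returns ::
    "'a set \<Rightarrow> 'a set set \<Rightarrow> 'a set set \<Rightarrow> ('a set \<Rightarrow> real) \<Rightarrow> 'a set set \<Rightarrow> bool" where
  "gh_returns V \<I> E w P \<longleftrightarrow>
     (\<exists>C. gh_reaches V \<I> E w C \<and> \<not> card C < matroid_rank \<I> - 1 \<and> P = components V (E - C))"

end

theory Submission imports Defs begin

text \<open>Order the parts of an optimal partition so that \<open>f\<close> increases, \<open>f V\<^sub>0 \<le> \<dots> \<le> f V\<^sub>k\<^sub>-\<^sub>1\<close>, and let
  \<open>b\<^sub>i \<in> V\<^sub>i\<close> be the elements of the base that witnesses feasibility. Since \<open>V\<^sub>i\<close> cuts \<open>b\<^sub>i\<close> from \<open>b\<^sub>l\<close>,
  the tree path between them has an edge of weight at most \<open>f V\<^sub>i\<close>; hence the tree edges of weight at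
  most \<open>f V\<^sub>j\<close> separate the \<open>j + 2\<close> independent elements \<open>b\<^sub>0, \<dots>, b\<^sub>j\<^sub>+\<^sub>1\<close>, and one of them can be added
  to any \<open>j\<close> edges chosen so far. So the greedy choice costs at most \<open>f V\<^sub>j\<close> in step \<open>j\<close>, and never pays
  for the most expensive part. On the other hand, cutting a tree edge \<open>e\<close> raises the total value of
  the components by at most \<open>2 w e\<close>.\<close>

section \<open>Reachability and components\<close>

definition component :: "'a set \<Rightarrow> 'a set set \<Rightarrow> 'a \<Rightarrow> 'a set" where
  "component V E u = {v \<in> V. (u, v) \<in> reachable E}"

lemma components_eq_image: "components V E = component V E ` V"
  by (auto simp: components_def component_def)

lemma reachable_refl [simp]: "(u, u) \<in> reachable E"
  by (simp add: reachable_def)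

lemma reachable_trans: "(u, v) \<in> reachable E \<Longrightarrow> (v, x) \<in> reachable E \<Longrightarrow> (u, x) \<in> reachable E"
  unfolding reachable_def by (rule rtrancl_trans)

lemma reachable_edge: "{u, v} \<in> E \<Longrightarrow> (u, v) \<in> reachable E"
  by (auto simp: reachable_def)

lemma reachable_sym: "(u, v) \<in> reachable E \<Longrightarrow> (v, u) \<in> reachable E"
proof -
  have "sym {(u, v). {u, v} \<in> E}" by (auto simp: sym_def insert_commute)
  then show "(u, v) \<in> reachable E \<Longrightarrow> (v, u) \<in> reachable E"
    unfolding reachable_def by (meson sym_rtrancl symD)
qed

lemma reachable_mono: "(u, v) \<in> reachable E \<Longrightarrow> E \<subseteq> E' \<Longrightarrow> (u, v) \<in> reachable E'"
  unfolding reachable_def by (erule rtrancl_mono[THEN subsetD, rotated]) auto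

text \<open>Induction along the walk: crossing \<open>{x, y}\<close> back and forth cancels, so a
  walk can be shortened until it uses this edge at most once, in one of the two directions.\<close>

lemma reachable_avoiding_edge:
  assumes "(u, v) \<in> reachable E"
  shows "(u, v) \<in> reachable (E - {{x, y}}) \<or>
    (u, x) \<in> reachable (E - {{x, y}}) \<and> (y, v) \<in> reachable (E - {{x, y}}) \<or>
    (u, y) \<in> reachable (E - {{x, y}}) \<and> (x, v) \<in> reachable (E - {{x, y}})"
  using assms unfolding reachable_def[of E]
proof (induction rule: rtrancl_induct)
  case base
  then show ?case by simp
next
  case (step v z)
  show ?case
  proof (cases "{v, z} = {x, y}")
    case True
    then have "v = x \<and> z = y \<or> v = y \<and> z = x" by (auto simp: doubleton_eq_iff)
    with step.IH show ?thesis by auto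
  next
    case False
    with step.hyps have "(v, z) \<in> reachable (E - {{x, y}})" by (intro reachable_edge) auto
    with step.IH show ?thesis by (meson reachable_trans)
  qed
qed

lemma reachable_imp_path:
  assumes "(s, t) \<in> reachable E"
  shows "\<exists>p. path E s t p"
  using assms unfolding reachable_def
proof (induction rule: converse_rtrancl_induct)
  case base
  have "path E t t [t]" by (simp add: path_def)
  then show ?case ..
next
  case (step s u)
  then obtain p where p: "path E u t p" by blast
  show ?case
  proof (cases "s \<in> set p")
    \<comment> \<open>If \<open>s\<close> reoccurs on the path, the detour before that occurrence is
      dropped, which keeps the path simple.\<close>
    case True
    then obtain xs ys where "p = xs @ s # ys" by (auto simp: in_set_conv_decomp)
    with p have "path E s t (s # ys)" by (auto simp: path_def successively_append_iff)
    then show ?thesis ..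
  next
    case False
    with p step.hyps have "path E s t (s # p)"
      by (auto simp: path_def successively_Cons)
    then show ?thesis ..
  qed
qed

lemma path_edges_subset: "path E s t p \<Longrightarrow> path_edges p \<subseteq> E"
  by (auto simp: path_def path_edges_def successively_conv_nth in_set_zip nth_tl)

lemma path_edges_finite_nonempty:
  assumes "path E s t p" "s \<noteq> t"
  shows "finite (path_edges p)" "path_edges p \<noteq> {}"
proof -
  have eq: "path_edges p = (\<lambda>(u, v). {u, v}) ` set (zip p (tl p))"
    by (auto simp: path_edges_def)
  show "finite (path_edges p)" by (simp add: eq)
  obtain a b q where "p = a # b # q"
    using assms by (cases p; cases "tl p") (auto simp: path_def)
  then show "path_edges p \<noteq> {}" unfolding eq by simp
qed

text \<open>A path from \<open>x\<close> to \<open>y\<close> that avoids the edge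
  \<open>{x, y}\<close> would close up with it to a cycle. The subset \<open>E'\<close> allows for
  edges that were cut before.\<close>

lemma bridge_in_acyclic:
  assumes "\<nexists>c. cycle E c" "{x, y} \<in> E" "x \<noteq> y" "E' \<subseteq> E"
  shows "(x, y) \<notin> reachable (E' - {{x, y}})"
proof
  assume "(x, y) \<in> reachable (E' - {{x, y}})"
  then obtain p where p: "path (E' - {{x, y}}) x y p" using reachable_imp_path by metis
  from p \<open>x \<noteq> y\<close> obtain b q where q: "p = x # b # q"
    by (cases p; cases "tl p") (auto simp: path_def)
  \<comment> \<open>A two-vertex path would consist of the deleted edge itself.\<close>
  with p have "q \<noteq> []" by (auto simp: path_def)
  then have "length p \<ge> 3" using q by (cases q) auto
  moreover have "successively (\<lambda>u v. {u, v} \<in> E) p"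
    using p \<open>E' \<subseteq> E\<close> by (auto simp: path_def intro: successively_mono)
  ultimately have "cycle E p"
    using p assms(2) by (auto simp: cycle_def path_def insert_commute)
  with assms(1) show False by blast
qed

lemma in_component_self: "u \<in> V \<Longrightarrow> u \<in> component V E u"
  by (simp add: component_def)

lemma component_eqI: "(u, v) \<in> reachable E \<Longrightarrow> component V E u = component V E v"
  unfolding component_def
  using reachable_trans[of u v E] reachable_trans[of v u E] reachable_sym[of u v E] by auto

lemma mem_component_eq: "v \<in> component V E u \<Longrightarrow> component V E u = component V E v"
  by (rule component_eqI) (simp add: component_def)

lemma component_eq_of_mem: "D \<in> components V E \<Longrightarrow> u \<in> D \<Longrightarrow> D = component V E u"
  unfolding components_eq_image using mem_component_eq by (metis imageE)

lemma components_partition_on: "partition_on V (components V E)"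
proof (rule partition_onI)
  show "\<Union> (components V E) = V"
    by (auto simp: components_eq_image component_def)
  show "disjnt D D'" if "D \<in> components V E" "D' \<in> components V E" "D \<noteq> D'" for D D'
    using that component_eq_of_mem by (metis disjnt_iff)
qed (auto simp: components_eq_image component_def)

lemma components_unique:
  "D \<in> components V E \<Longrightarrow> D' \<in> components V E \<Longrightarrow> u \<in> D \<Longrightarrow> u \<in> D' \<Longrightarrow> D = D'"
  by (metis component_eq_of_mem)

lemma simple_graph_subset: "simple_graph V E \<Longrightarrow> E' \<subseteq> E \<Longrightarrow> simple_graph V E'"
  by (auto simp: simple_graph_def)

lemma simple_graph_edgeD:
  assumes "simple_graph V E" "{x, y} \<in> E"
  shows "x \<in> V" "y \<in> V" "x \<noteq> y"
  using assms by (auto simp: simple_graph_def card_2_iff doubleton_eq_iff)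

lemma simple_graph_finite: "simple_graph V E \<Longrightarrow> finite V \<Longrightarrow> finite E"
  by (rule finite_subset[of _ "Pow V"]) (auto simp: simple_graph_def)

text \<open>Delete the edges of \<open>F\<close> one after another: the edge whose deletion first
  disconnects \<open>u\<close> from \<open>v\<close> is the one sought. It is oriented so that
  \<open>x\<close> lies on the side of \<open>u\<close>.\<close>

lemma separating_edge:
  assumes "finite F" "simple_graph V E" "(u, v) \<in> reachable E" "(u, v) \<notin> reachable (E - F)"
  shows "\<exists>x y. {x, y} \<in> E \<inter> F \<and> (u, x) \<in> reachable (E - {{x, y}}) \<and>
    (y, v) \<in> reachable (E - {{x, y}})"
  using assms(1,4)
proof (induction F rule: finite_induct)
  case empty
  with assms(3) show ?case by simp
next
  case (insert e F)
  show ?case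
  proof (cases "(u, v) \<in> reachable (E - F)")
    case False
    with insert.IH show ?thesis by blast
  next
    case True
    have eq: "E - insert e F = E - F - {e}" by auto
    have "e \<in> E" using True insert.prems unfolding eq by (cases "e \<in> E") auto
    then obtain x y where e: "e = {x, y}"
      using assms(2) by (auto simp: simple_graph_def card_2_iff)
    have mono: "(a, b) \<in> reachable (E - {e})" if "(a, b) \<in> reachable (E - F - {e})" for a b
      using that by (rule reachable_mono) auto
    have "(u, x) \<in> reachable (E - {e}) \<and> (y, v) \<in> reachable (E - {e}) \<or>
      (u, y) \<in> reachable (E - {e}) \<and> (x, v) \<in> reachable (E - {e})"
      using reachable_avoiding_edge[OF True, of x y] insert.prems mono
      unfolding e[symmetric] eq by blast
    then show ?thesis
    proof
      assume "(u, x) \<in> reachable (E - {e}) \<and> (y, v) \<in> reachable (E - {e})"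
      with \<open>e \<in> E\<close> e show ?thesis by blast
    next
      assume "(u, y) \<in> reachable (E - {e}) \<and> (x, v) \<in> reachable (E - {e})"
      moreover have "e = {y, x}" using e by auto
      ultimately show ?thesis using \<open>e \<in> E\<close> by blast
    qed
  qed
qed

section \<open>Components after deleting a single edge\<close>

lemma component_remove_edge:
  assumes "{x, y} \<in> E"
  shows "component V E x =
    component V (E - {{x, y}}) x \<union> component V (E - {{x, y}}) y"
proof -
  have "(x, v) \<in> reachable (E - {{x, y}}) \<or> (y, v) \<in> reachable (E - {{x, y}})"
    if "(x, v) \<in> reachable E" for v
    using reachable_avoiding_edge[OF that, of x y] by blast
  moreover have "(x, v) \<in> reachable E"
    if "(x, v) \<in> reachable (E - {{x, y}}) \<or> (y, v) \<in> reachable (E - {{x, y}})" for v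
  proof -
    have "(x, v) \<in> reachable E \<or> (y, v) \<in> reachable E"
      using that by (meson Diff_subset reachable_mono)
    then show ?thesis using reachable_edge[OF assms] reachable_trans by metis
  qed
  ultimately show ?thesis by (auto simp: component_def)
qed

lemma components_remove_edge:
  assumes "simple_graph V E" "{x, y} \<in> E"
  shows "components V (E - {{x, y}}) = insert (component V (E - {{x, y}}) x)
    (insert (component V (E - {{x, y}}) y) (components V E - {component V E x}))"
proof -
  let ?E = "E - {{x, y}}"
  note xy = simple_graph_edgeD[OF assms]
  \<comment> \<open>A component that misses \<open>x\<close> misses \<open>y\<close> too, so none of
    its walks uses the deleted edge.\<close>
  have same: "component V ?E u = component V E u" if "(u, x) \<notin> reachable E" for u
  proof -
    have "(u, v) \<in> reachable ?E" if "(u, v) \<in> reachable E" for v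
    proof -
      have "(u, y) \<notin> reachable E"
        using \<open>(u, x) \<notin> reachable E\<close> reachable_sym[OF reachable_edge[OF assms(2)]] reachable_trans
        by metis
      then show ?thesis
        using reachable_avoiding_edge[OF that, of x y] \<open>(u, x) \<notin> reachable E\<close>
        by (meson Diff_subset reachable_mono)
    qed
    then show ?thesis by (auto simp: component_def intro: reachable_mono)
  qed
  have split: "component V ?E u = component V ?E x \<or> component V ?E u = component V ?E y"
    if "(u, x) \<in> reachable E" for u
    using reachable_avoiding_edge[OF that, of x y] by (auto dest: component_eqI)
  have neq: "component V E u \<noteq> component V E x" if "(u, x) \<notin> reachable E" for u
  proof
    assume "component V E u = component V E x"
    then have "x \<in> component V E u" using in_component_self[OF xy(1)] by metis
    then show False using that by (simp add: component_def)
  qed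
  show ?thesis
  proof (intro equalityI subsetI)
    fix D assume "D \<in> components V ?E"
    then obtain u where "u \<in> V" "D = component V ?E u" by (auto simp: components_eq_image)
    then show "D \<in> insert (component V ?E x) (insert (component V ?E y)
        (components V E - {component V E x}))"
      using same split neq by (cases "(u, x) \<in> reachable E") (auto simp: components_eq_image)
  next
    fix D assume "D \<in> insert (component V ?E x) (insert (component V ?E y)
        (components V E - {component V E x}))"
    then consider "D = component V ?E x" | "D = component V ?E y"
      | u where "u \<in> V" "D = component V E u" "D \<noteq> component V E x"
      by (auto simp: components_eq_image)
    then show "D \<in> components V ?E"
    proof cases
      case 3
      then have "(u, x) \<notin> reachable E" by (auto dest: component_eqI)
      then have "D = component V ?E u" using same 3(2) by simp
      with 3(1) show ?thesis by (simp add: components_eq_image)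
    qed (use xy in \<open>auto simp: components_eq_image\<close>)
  qed
qed

lemma component_bridge_disjoint:
  "(x, y) \<notin> reachable E \<Longrightarrow> component V E x \<inter> component V E y = {}"
  unfolding component_def
  using reachable_trans[of x _ E y] reachable_sym[of y _ E] by auto

text \<open>For a bridge, the insertions in \<open>components_remove_edge\<close> are proper, so
  cardinalities and sums over the new components can be split term by term.\<close>

lemma bridge_parts_new:
  assumes "simple_graph V E" "{x, y} \<in> E" "(x, y) \<notin> reachable (E - {{x, y}})"
  shows "component V (E - {{x, y}}) x \<notin> components V E - {component V E x}"
    and "component V (E - {{x, y}}) y \<notin> components V E - {component V E x}"
    and "component V (E - {{x, y}}) x \<noteq> component V (E - {{x, y}}) y"
proof -
  let ?E = "E - {{x, y}}"
  note xy = simple_graph_edgeD[OF assms(1,2)]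
  have eq: "component V E y = component V E x"
    using component_eqI[OF reachable_edge[OF assms(2)]] by metis
  show "component V ?E x \<notin> components V E - {component V E x}"
    using component_eq_of_mem in_component_self[OF xy(1), of ?E] by fastforce
  show "component V ?E y \<notin> components V E - {component V E x}"
    using component_eq_of_mem in_component_self[OF xy(2), of ?E] eq by fastforce
  show "component V ?E x \<noteq> component V ?E y"
    using component_bridge_disjoint[OF assms(3)] in_component_self[OF xy(1)] by fastforce
qed

lemma finite_components: "finite V \<Longrightarrow> finite (components V E)"
  by (simp add: components_eq_image)

lemma tree_components:
  assumes "tree V E"
  shows "components V E = {V}"
proof -
  have "component V E u = V" if "u \<in> V" for u
    using assms that by (auto simp: component_def tree_def)
  then show ?thesis using assms by (auto simp: components_eq_image tree_def)
qed

lemma tree_bridge: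
  assumes "tree V E" "{x, y} \<in> E" "E' \<subseteq> E"
  shows "(x, y) \<notin> reachable (E' - {{x, y}})"
  using assms simple_graph_edgeD(3)[OF _ assms(2), of V]
  by (intro bridge_in_acyclic[of E]) (auto simp: tree_def)

text \<open>Every remaining tree edge is a bridge, so each further deletion replaces one component
  by two.\<close>

lemma card_components_tree:
  assumes "tree V E" "finite V" "X \<subseteq> E"
  shows "card (components V (E - X)) = card X + 1"
proof -
  have sg: "simple_graph V E" using assms(1) by (simp add: tree_def)
  have "finite X" using simple_graph_finite[OF sg assms(2)] assms(3) finite_subset by blast
  then show ?thesis using assms(3)
  proof (induction X rule: finite_induct)
    case empty
    show ?case by (simp add: tree_components[OF assms(1)])
  next
    case (insert e X)
    then obtain x y where e: "e = {x, y}"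
      using sg by (auto simp: simple_graph_def card_2_iff)
    have sg': "simple_graph V (E - X)" by (rule simple_graph_subset[OF sg]) auto
    have e': "{x, y} \<in> E - X" using insert e by auto
    have br: "(x, y) \<notin> reachable (E - X - {{x, y}})"
      using insert.prems e by (intro tree_bridge[OF assms(1)]) auto
    have eq: "E - insert e X = E - X - {{x, y}}" using e by auto
    note new = bridge_parts_new[OF sg' e' br]
    have mem: "component V (E - X) x \<in> components V (E - X)"
      using simple_graph_edgeD[OF sg' e'] by (auto simp: components_eq_image)
    have fin: "finite (components V (E - X))" using finite_components[OF assms(2)] .
    have "card (components V (E - insert e X)) =
        Suc (Suc (card (components V (E - X) - {component V (E - X) x})))"
      unfolding eq components_remove_edge[OF sg' e'] using new fin by simp
    also have "\<dots> = Suc (card (components V (E - X)))"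
      using card.remove[OF fin mem] by simp
    finally show ?case using insert by simp
  qed
qed

section \<open>The cost of cutting tree edges\<close>

text \<open>The Gomory-Hu condition is applied to the path \<open>[x, y]\<close>, whose single edge
  is its own minimum. Hence every tree edge induces a cut whose value is its weight.\<close>

lemma gomory_hu_edge_cut:
  assumes "gomory_hu_tree V f E w" "{x, y} \<in> E"
  shows "f (component V (E - {{x, y}}) x) = w {x, y} \<or>
    f (component V (E - {{x, y}}) y) = w {x, y}"
    "component V (E - {{x, y}}) y = V - component V (E - {{x, y}}) x"
proof -
  have tree: "tree V E" using assms(1) by (simp add: gomory_hu_tree_def)
  then have xy: "x \<in> V" "y \<in> V" "x \<noteq> y"
    using simple_graph_edgeD[OF _ assms(2)] by (auto simp: tree_def)
  have p: "path E x y [x, y]" using assms(2) xy by (simp add: path_def)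
  have pe: "path_edges [x, y] = {{x, y}}" by (auto simp: path_edges_def)
  obtain S where S: "S \<in> cuts V x y" "f S = w {x, y}"
    "components V (E - {{x, y}}) = {S, V - S}"
    using assms(1) xy p pe unfolding gomory_hu_tree_def by force
  have "component V (E - {{x, y}}) x \<in> {S, V - S}" "component V (E - {{x, y}}) y \<in> {S, V - S}"
    using S(3) xy by (auto simp: components_eq_image)
  moreover have "x \<in> component V (E - {{x, y}}) x" "y \<in> component V (E - {{x, y}}) y"
    using xy by (auto simp: in_component_self)
  ultimately have "component V (E - {{x, y}}) x = S" "component V (E - {{x, y}}) y = V - S"
    using S(1) by (auto simp: cuts_def)
  then show "f (component V (E - {{x, y}}) x) = w {x, y} \<or>
      f (component V (E - {{x, y}}) y) = w {x, y}"
    "component V (E - {{x, y}}) y = V - component V (E - {{x, y}}) x"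
    using S(2) by auto
qed

text \<open>Submodularity is used twice: for \<open>X\<close> and \<open>S\<close>, and for the
  complement of \<open>X \<union> S\<close> together with \<open>S\<close>. By symmetry and
  nonnegativity the second use yields \<open>f (X - S) \<le> f (X \<union> S) + f S\<close>, and
  \<open>f (X \<union> S)\<close> cancels in the sum.\<close>

lemma submodular_split_cost:
  assumes "submodular_on V f" "symmetric_on V f" "\<And>A. A \<subseteq> V \<Longrightarrow> f A \<ge> 0"
    and "X \<subseteq> V" "S \<subseteq> V"
  shows "f (X \<inter> S) + f (X - S) \<le> f X + 2 * f S"
proof -
  have "f (X \<union> S) + f (X \<inter> S) \<le> f X + f S"
    using assms by (auto simp: submodular_on_def)
  moreover have "f ((V - (X \<union> S)) \<union> S) + f ((V - (X \<union> S)) \<inter> S) \<le> f (V - (X \<union> S)) + f S"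
    using assms by (auto simp: submodular_on_def)
  moreover have "f (V - (X \<union> S)) = f (X \<union> S)"
    using assms by (metis symmetric_on_def Un_least)
  moreover have "(V - (X \<union> S)) \<union> S = V - (X - S)" using assms by auto
  moreover have "f (V - (X - S)) = f (X - S)"
    using assms by (metis symmetric_on_def Diff_subset subset_trans)
  moreover have "f ((V - (X \<union> S)) \<inter> S) \<ge> 0" using assms(5) by (intro assms(3)) auto
  ultimately show ?thesis by simp
qed

text \<open>Induction on the cut edges: a new edge \<open>e\<close> splits only the component
  \<open>X\<close> that contains it, along the side \<open>S\<close> of its cut in the whole tree,
  where \<open>f S = w e\<close>.\<close>

lemma sum_components_le:
  assumes "finite V" "submodular_on V f" "symmetric_on V f" "\<And>A. A \<subseteq> V \<Longrightarrow> f A \<ge> 0"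
    and "f {} = 0" "gomory_hu_tree V f E w" "C \<subseteq> E"
  shows "(\<Sum>X\<in>components V (E - C). f X) \<le> 2 * (\<Sum>e\<in>C. w e)"
proof -
  have tree: "tree V E" using assms(6) by (simp add: gomory_hu_tree_def)
  then have sg: "simple_graph V E" by (simp add: tree_def)
  have "finite C" using simple_graph_finite[OF sg assms(1)] assms(7) finite_subset by blast
  then show ?thesis using assms(7)
  proof (induction C rule: finite_induct)
    case empty
    have "f V = f (V - V)" using assms(3) unfolding symmetric_on_def by blast
    then show ?case by (simp add: tree_components[OF tree] assms(5))
  next
    case (insert e C)
    then obtain x y where e: "e = {x, y}"
      using sg by (auto simp: simple_graph_def card_2_iff)
    let ?E = "E - C - {{x, y}}"
    define S where "S = component V (E - {{x, y}}) x"
    define X where "X = component V (E - C) x"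
    have sg': "simple_graph V (E - C)" by (rule simple_graph_subset[OF sg]) auto
    have e': "{x, y} \<in> E - C" using insert e by auto
    have br: "(x, y) \<notin> reachable ?E"
      using insert.prems e by (intro tree_bridge[OF tree]) auto
    have eq: "E - insert e C = ?E" using e by auto
    note new = bridge_parts_new[OF sg' e' br]
    have mem: "X \<in> components V (E - C)"
      using simple_graph_edgeD[OF sg' e'] by (auto simp: components_eq_image X_def)
    have fin: "finite (components V (E - C))" using finite_components[OF assms(1)] .
    have SV: "S \<subseteq> V" and XV: "X \<subseteq> V" by (auto simp: S_def X_def component_def)
    have cut: "component V (E - {{x, y}}) y = V - S" "f S = w e"
    proof -
      show *: "component V (E - {{x, y}}) y = V - S"
        unfolding S_def by (rule gomory_hu_edge_cut[OF assms(6)]) (use e' in auto)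
      have "f S = w e \<or> f (V - S) = w e"
        using gomory_hu_edge_cut(1)[OF assms(6), of x y] e' * e by (auto simp: S_def)
      moreover have "f (V - S) = f S" using assms(3) SV unfolding symmetric_on_def by metis
      ultimately show "f S = w e" by auto
    qed
    have X: "X = component V ?E x \<union> component V ?E y"
      unfolding X_def using component_remove_edge[OF e'] .
    \<comment> \<open>Having cut \<open>C\<close> as well only shrinks components, so each half of
      \<open>X\<close> stays on its own side of the cut \<open>S\<close>.\<close>
    have "component V ?E u \<subseteq> component V (E - {{x, y}}) u" for u
      by (auto simp: component_def elim: reachable_mono)
    then have "component V ?E x \<subseteq> S" "component V ?E y \<subseteq> V - S"
      using cut(1) S_def by blast+
    with X have parts: "component V ?E x = X \<inter> S" "component V ?E y = X - S" by auto
    have "(\<Sum>Y\<in>components V (E - insert e C). f Y) =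
        f (X \<inter> S) + (f (X - S) + (\<Sum>Y\<in>components V (E - C) - {X}. f Y))"
      unfolding eq components_remove_edge[OF sg' e'] using new fin
      by (simp add: X_def[symmetric] parts)
    also have "\<dots> \<le> f X + 2 * w e + (\<Sum>Y\<in>components V (E - C) - {X}. f Y)"
      using submodular_split_cost[OF assms(2-4) XV SV] cut(2) by simp
    also have "\<dots> = (\<Sum>Y\<in>components V (E - C). f Y) + 2 * w e"
      using sum.remove[OF fin mem, of f] by simp
    finally show ?case using insert by simp
  qed
qed

section \<open>Independent transversals and augmentation\<close>

text \<open>A set-based substitute for the choice function in \<open>edge_indep\<close>, suited to
  exchanging single elements. The inclusion in \<open>\<Union>P\<close> excludes elements outside
  all parts.\<close>

definition transversal :: "'a set set \<Rightarrow> 'a set \<Rightarrow> bool" where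
  "transversal P T \<longleftrightarrow> T \<subseteq> \<Union>P \<and> (\<forall>D\<in>P. \<exists>t. T \<inter> D = {t})"

lemma transversal_card:
  assumes "partition_on V P" "transversal P T"
  shows "card T = card P"
proof -
  obtain v where v: "\<And>D. D \<in> P \<Longrightarrow> T \<inter> D = {v D}"
    using assms(2) unfolding transversal_def by metis
  have "v ` P = T" using v assms(2) by (fastforce simp: transversal_def)
  moreover have "inj_on v P"
  proof (rule inj_onI)
    fix D D' assume "D \<in> P" "D' \<in> P" "v D = v D'"
    then have "v D \<in> D \<inter> D'" using v by fastforce
    then show "D = D'" using assms(1) \<open>D \<in> P\<close> \<open>D' \<in> P\<close>
      using disjointD[OF partition_onD2] by (metis empty_iff)
  qed
  ultimately show ?thesis using card_image by blast
qed

context matroid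
begin

text \<open>Components are disjoint, so the image of a choice function meets each of them exactly
  once. Conversely, the representatives read off from \<open>T\<close> form a subset of
  \<open>T\<close>, which is independent by heredity.\<close>

lemma edge_indep_iff:
  "X \<in> edge_indep V \<I> E \<longleftrightarrow> X \<subseteq> E \<and> (\<exists>T\<in>\<I>. transversal (components V (E - X)) T)"
proof -
  let ?P = "components V (E - X)"
  have "transversal ?P (v ` ?P)" if "\<forall>D\<in>?P. v D \<in> D" for v
  proof -
    have "v ` ?P \<inter> D = {v D}" if "D \<in> ?P" for D
      using that \<open>\<forall>D\<in>?P. v D \<in> D\<close> components_unique by fastforce
    then show ?thesis using that by (auto simp: transversal_def)
  qed
  moreover have "\<exists>v. (\<forall>D\<in>?P. v D \<in> D) \<and> v ` ?P \<in> \<I>" if T: "T \<in> \<I>" "transversal ?P T" for T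
  proof -
    obtain v where v: "\<And>D. D \<in> ?P \<Longrightarrow> T \<inter> D = {v D}"
      using T(2) unfolding transversal_def by metis
    then have "v ` ?P \<subseteq> T" "\<forall>D\<in>?P. v D \<in> D" by blast+
    then show ?thesis using indep_mono[OF T(1)] by blast
  qed
  ultimately show ?thesis unfolding edge_indep_def by blast
qed

section \<open>Independent sets, rank and bases\<close>

lemma indep_finite: "X \<in> \<I> \<Longrightarrow> finite X"
  by (rule finite_subset[OF indep_subset_ground finite_ground])

lemma finite_indep_sets: "finite \<I>"
  by (rule finite_subset[of \<I> "Pow V"]) (auto simp: finite_ground dest: indep_subset_ground)

lemma card_le_rank: "X \<in> \<I> \<Longrightarrow> card X \<le> matroid_rank \<I>"
  unfolding matroid_rank_def using finite_indep_sets by simp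

lemma ex_indep_card_rank: "\<exists>X\<in>\<I>. card X = matroid_rank \<I>"
proof -
  have "Max (card ` \<I>) \<in> card ` \<I>"
    using finite_indep_sets empty_indep by (intro Max_in) auto
  then show ?thesis by (auto simp: matroid_rank_def)
qed

text \<open>A maximal independent set below the rank could be augmented from an independent set of
  full rank.\<close>

lemma base_iff_card: "B \<in> bases \<I> \<longleftrightarrow> B \<in> \<I> \<and> card B = matroid_rank \<I>"
proof
  assume B: "B \<in> bases \<I>"
  obtain X where X: "X \<in> \<I>" "card X = matroid_rank \<I>" using ex_indep_card_rank by blast
  have "\<not> card B < card X" using augment[of B X] B X(1) by (auto simp: bases_def)
  with B X card_le_rank show "B \<in> \<I> \<and> card B = matroid_rank \<I>"
    by (fastforce simp: bases_def)
next
  assume B: "B \<in> \<I> \<and> card B = matroid_rank \<I>"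
  have "X = B" if "X \<in> \<I>" "B \<subseteq> X" for X
    using card_seteq[OF indep_finite[OF that(1)] that(2)] card_le_rank[OF that(1)] B by simp
  with B show "B \<in> bases \<I>" by (auto simp: bases_def)
qed

text \<open>Augment the transversal \<open>T\<close> by some \<open>b \<in> B\<close> in the matroid. If \<open>F\<close> separates \<open>b\<close> from the
  representative \<open>t\<close> of its component, an edge of \<open>F\<close> between them can be cut; otherwise exchanging
  \<open>t\<close> for \<open>b\<close> yields a transversal that has more elements in common with \<open>B\<close>.\<close>

lemma edge_indep_augment:
  assumes "tree V E" "C \<in> edge_indep V \<I> E" "F \<subseteq> E"
    and "B \<in> \<I>" "card B \<ge> card C + 2"
    and sep: "\<And>a b. a \<in> B \<Longrightarrow> b \<in> B \<Longrightarrow> a \<noteq> b \<Longrightarrow> (a, b) \<notin> reachable (E - F)"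
  shows "\<exists>e\<in>F - C. insert e C \<in> edge_indep V \<I> E"
proof -
  let ?P = "components V (E - C)"
  have sg: "simple_graph V E" using assms(1) by (simp add: tree_def)
  have sg': "simple_graph V (E - C)" by (rule simple_graph_subset[OF sg]) auto
  have finF: "finite F"
    using simple_graph_finite[OF sg finite_ground] assms(3) finite_subset by blast
  have CE: "C \<subseteq> E" using assms(2) by (simp add: edge_indep_iff)
  have U: "\<Union>?P = V" using partition_onD1[OF components_partition_on] by metis
  have "?thesis" if "T \<in> \<I>" "transversal ?P T" for T
    using that
  \<comment> \<open>The measure drops with every exchange that brings \<open>T\<close> closer to
    \<open>B\<close>.\<close>
  proof (induction "card (B - T)" arbitrary: T rule: less_induct)
    case less
    note T = less.prems
    have "card T = card C + 1"
      using transversal_card[OF components_partition_on T(2)]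
        card_components_tree[OF assms(1) finite_ground CE] by simp
    \<comment> \<open>\<open>T\<close> has \<open>card C + 1\<close> elements, one fewer than the
      bound assumed for \<open>B\<close>, so augmentation applies.\<close>
    then obtain b where b: "b \<in> B - T" "insert b T \<in> \<I>"
      using augment[OF T(1) assms(4)] assms(5) by auto
    have bV: "b \<in> V" using b indep_subset_ground by blast
    define D where "D = component V (E - C) b"
    have D: "D \<in> ?P" "b \<in> D" using bV by (auto simp: D_def components_eq_image in_component_self)
    obtain t where t: "T \<inter> D = {t}" using T(2) D(1) by (auto simp: transversal_def)
    have tV: "t \<in> V" using t D_def by (auto simp: component_def)
    have tb: "(t, b) \<in> reachable (E - C)" using t by (auto simp: D_def component_def intro: reachable_sym)
    show ?case
    proof (cases "(t, b) \<in> reachable (E - F)")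
      case True
      let ?T = "insert b T - {t}"
      \<comment> \<open>\<open>b\<close> lies outside \<open>T\<close>, so \<open>t\<close> and
        \<open>b\<close> are distinct; as they are connected without \<open>F\<close>, they cannot
        both belong to \<open>B\<close>.\<close>
      have "t \<notin> B" using sep[of t b] True b t by auto
      have "?T \<in> \<I>" by (rule indep_mono[OF b(2)]) auto
      moreover have "transversal ?P ?T"
        unfolding transversal_def
      proof (intro conjI ballI)
        show "?T \<subseteq> \<Union>?P" using U b(2) indep_subset_ground by blast
        fix D' assume D': "D' \<in> ?P"
        show "\<exists>s. ?T \<inter> D' = {s}"
        proof (cases "D' = D")
          case True
          then have "?T \<inter> D' = {b}" using t D b by auto
          then show ?thesis ..
        next
          case False
          then have "b \<notin> D'" "t \<notin> D'" using components_unique[OF D(1) D'] D(2) t by auto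
          then have "?T \<inter> D' = T \<inter> D'" by auto
          with T(2) D' show ?thesis by (auto simp: transversal_def)
        qed
      qed
      moreover have "card (B - ?T) < card (B - T)"
        using b \<open>t \<notin> B\<close> indep_finite[OF assms(4)] by (intro psubset_card_mono) auto
      ultimately show ?thesis using less.hyps by blast
    next
      case False
      \<comment> \<open>\<open>t\<close> and \<open>b\<close> share a component of
        \<open>E - C\<close>, so some edge of \<open>F\<close> outside \<open>C\<close> separates
        them. Cutting it leaves \<open>t\<close> and \<open>b\<close> as representatives of the two
        halves of \<open>D\<close>.\<close>
      then have "(t, b) \<notin> reachable (E - C - F)"
        using reachable_mono[of t b "E - C - F" "E - F"] by auto
      then obtain x y where xy: "{x, y} \<in> (E - C) \<inter> F"
        and tx: "(t, x) \<in> reachable (E - C - {{x, y}})"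
        and yb: "(y, b) \<in> reachable (E - C - {{x, y}})"
        using separating_edge[OF finF sg' tb] by blast
      let ?E = "E - C - {{x, y}}"
      have br: "(x, y) \<notin> reachable ?E" using xy by (intro tree_bridge[OF assms(1)]) auto
      have "(t, x) \<in> reachable (E - C)" using tx by (rule reachable_mono) auto
      then have "D = component V (E - C) x"
        unfolding D_def using tb component_eqI by metis
      then have comps: "components V ?E =
          insert (component V ?E x) (insert (component V ?E y) (?P - {D}))"
        and DU: "D = component V ?E x \<union> component V ?E y"
        using components_remove_edge[OF sg', of x y] component_remove_edge[of x y "E - C" V] xy
        by simp_all
      have "t \<in> component V ?E x" "b \<in> component V ?E y"
        using tx yb tV bV by (auto simp: component_def intro: reachable_sym)
      moreover have "component V ?E x \<inter> component V ?E y = {}"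
        using component_bridge_disjoint[OF br] .
      ultimately have "insert b T \<inter> component V ?E x = {t}" "insert b T \<inter> component V ?E y = {b}"
        using t DU by blast+
      moreover have "\<exists>s. insert b T \<inter> D' = {s}" if "D' \<in> ?P - {D}" for D'
      proof -
        have "b \<notin> D'" using that components_unique[OF D(1) _ D(2)] by blast
        then show ?thesis using that T(2) by (auto simp: transversal_def)
      qed
      moreover have "insert b T \<subseteq> \<Union>(components V ?E)"
        using components_partition_on[of V ?E] b(2) indep_subset_ground by (auto simp: partition_on_def)
      ultimately have "transversal (components V ?E) (insert b T)"
        unfolding transversal_def using comps by auto
      moreover have "E - insert {x, y} C = ?E" by auto
      ultimately have "insert {x, y} C \<in> edge_indep V \<I> E"
        using xy CE b(2) by (auto simp: edge_indep_iff)
      then show ?thesis using xy by blast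
    qed
  qed
  then show ?thesis using assms(2) by (auto simp: edge_indep_iff)
qed

lemma empty_edge_indep:
  assumes "tree V E" "matroid_rank \<I> \<ge> 1"
  shows "{} \<in> edge_indep V \<I> E"
proof -
  obtain X where "X \<in> \<I>" "card X = matroid_rank \<I>" using ex_indep_card_rank by blast
  with assms(2) obtain x where "x \<in> X" by fastforce
  then have "{x} \<in> \<I>" "x \<in> V" using \<open>X \<in> \<I>\<close> indep_mono indep_subset_ground by blast+
  then show ?thesis
    by (auto simp: edge_indep_iff transversal_def tree_components[OF assms(1)])
qed

text \<open>The greedy loop never gets stuck: augmentation applies with \<open>F = E\<close> and an
  independent set of full rank, and a lightest admissible edge exists by finiteness.\<close>

lemma gh_step_exists:
  assumes "tree V E" "C \<in> edge_indep V \<I> E" "card C < matroid_rank \<I> - 1"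
  shows "\<exists>C'. gh_step V \<I> E w C C'"
proof -
  obtain B where B: "B \<in> \<I>" "card B = matroid_rank \<I>" using ex_indep_card_rank by blast
  \<comment> \<open>Without edges, any two distinct elements are separated.\<close>
  have "(a, b) \<notin> reachable (E - E)" if "a \<noteq> b" for a b :: 'a
    using that by (simp add: reachable_def)
  then obtain e where e: "e \<in> E - C" "insert e C \<in> edge_indep V \<I> E"
    using edge_indep_augment[OF assms(1,2) subset_refl B(1)] B(2) assms(3) by force
  define A where "A = {e \<in> E - C. insert e C \<in> edge_indep V \<I> E}"
  have "finite A" "A \<noteq> {}"
    using e assms(1) simple_graph_finite[OF _ finite_ground] by (auto simp: A_def tree_def)
  then have "arg_min_on w A \<in> A" "\<forall>e'\<in>A. w (arg_min_on w A) \<le> w e'"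
    using arg_min_if_finite[of A w] by (auto simp: not_less)
  then show ?thesis using assms(3) unfolding gh_step_def A_def by blast
qed

section \<open>Comparing the greedy edges with an optimal partition\<close>

text \<open>The cut \<open>S\<close> bounds the minimum cut between \<open>s\<close> and
  \<open>t\<close> by \<open>g\<close>, so the lightest edge \<open>e\<close> on their tree path has
  weight at most \<open>g\<close>. By the Gomory-Hu condition, removing \<open>e\<close> alone
  already separates \<open>s\<close> from \<open>t\<close>.\<close>

lemma light_edges_separate:
  assumes "gomory_hu_tree V f E w" "S \<in> cuts V s t" "t \<in> V" "f S \<le> g"
  shows "(s, t) \<notin> reachable (E - {e \<in> E. w e \<le> g})"
proof
  assume r: "(s, t) \<in> reachable (E - {e \<in> E. w e \<le> g})"
  have st: "s \<in> V" "s \<noteq> t" using assms(2) by (auto simp: cuts_def)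
  have "(s, t) \<in> reachable E"
    using assms(1,3) st by (auto simp: gomory_hu_tree_def tree_def)
  then obtain p where p: "path E s t p" using reachable_imp_path by metis
  have "Min (w ` path_edges p) \<in> w ` path_edges p"
    using path_edges_finite_nonempty[OF p st(2)] by (intro Min_in) auto
  then obtain e where e: "e \<in> path_edges p" "w e = Min (w ` path_edges p)" by auto
  then have eq: "w e = Min (f ` cuts V s t)"
    using assms(1,3) st p unfolding gomory_hu_tree_def by metis
  obtain S' where S': "S' \<in> cuts V s t" "components V (E - {e}) = {S', V - S'}"
    using assms(1,3) st p e unfolding gomory_hu_tree_def by metis
  have "finite (cuts V s t)"
    using finite_ground by (intro finite_subset[of "cuts V s t" "Pow V"]) (auto simp: cuts_def)
  then have "w e \<le> g" using eq assms(2,4) by (auto intro: order_trans[OF Min_le])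
  moreover have "e \<in> E" using path_edges_subset[OF p] e by blast
  ultimately have "(s, t) \<in> reachable (E - {e})" by (intro reachable_mono[OF r]) auto
  then have "component V (E - {e}) s = component V (E - {e}) t" by (rule component_eqI)
  moreover have "component V (E - {e}) s \<in> {S', V - S'}"
    using S'(2) st by (auto simp: components_eq_image)
  ultimately show False
    using S'(1) in_component_self[OF st(1), of "E - {e}"] in_component_self[OF assms(3), of "E - {e}"]
    by (auto simp: cuts_def)
qed

text \<open>With \<open>card C = j\<close>, the edges of weight at most \<open>f (Q ! j)\<close>
  separate \<open>j + 2\<close> elements of the base, which is exactly what
  \<open>edge_indep_augment\<close> asks for.\<close>

lemma gh_step_weight_le:
  assumes gh: "gomory_hu_tree V f E w" and step: "gh_step V \<I> E w C C'"
    and C: "C \<in> edge_indep V \<I> E"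
    and Q: "partition_on V (set Q)" "distinct Q" "sorted (map f Q)" "length Q = matroid_rank \<I>"
    and B: "B \<in> bases \<I>" "\<And>X. X \<in> set Q \<Longrightarrow> card (B \<inter> X) = 1"
  shows "\<exists>e\<in>E - C. C' = insert e C \<and> w e \<le> f (Q ! card C)"
proof -
  let ?j = "card C"
  let ?F = "{e \<in> E. w e \<le> f (Q ! ?j)}"
  have j: "?j + 2 \<le> length Q" using step Q(4) by (auto simp: gh_step_def)
  have "\<forall>i<length Q. \<exists>b. B \<inter> Q ! i = {b}" using B(2) by (auto simp: card_1_singleton_iff)
  then obtain b where b: "\<And>i. i < length Q \<Longrightarrow> B \<inter> Q ! i = {b i}" by metis
  have other: "b l \<notin> Q ! i" if "i < length Q" "l < length Q" "i \<noteq> l" for i l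
  proof
    assume "b l \<in> Q ! i"
    then have "Q ! i \<inter> Q ! l \<noteq> {}" using b[OF that(2)] by blast
    then show False
      using that Q(1,2) nth_eq_iff_index_eq by (metis disjointD nth_mem partition_onD2)
  qed
  let ?B = "b ` {..?j + 1}"
  have inB: "b i \<in> B \<inter> Q ! i" if "i \<le> ?j + 1" for i using b[of i] that j by auto
  have "inj_on b {..?j + 1}"
  proof (rule inj_onI, rule ccontr)
    fix i l assume "i \<in> {..?j + 1}" "l \<in> {..?j + 1}" "b i = b l" "i \<noteq> l"
    then show False using other[of i l] inB[of i] j by auto
  qed
  then have "card ?B \<ge> ?j + 2" by (simp add: card_image)
  moreover have "?B \<in> \<I>"
  proof (rule indep_mono)
    show "B \<in> \<I>" using B(1) by (simp add: bases_def)
    show "?B \<subseteq> B" using inB by blast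
  qed
  moreover have sep: "(b i, b l) \<notin> reachable (E - ?F)" if "i < l" "l \<le> ?j + 1" for i l
  proof (rule light_edges_separate[OF gh])
    have "Q ! i \<subseteq> V" using Q(1) that j by (auto simp: partition_on_def)
    then show "Q ! i \<in> cuts V (b i) (b l)"
      using inB[of i] other[of i l] that j by (auto simp: cuts_def)
    show "b l \<in> V"
      using inB[of l] that B(1) indep_subset_ground by (auto simp: bases_def)
    show "f (Q ! i) \<le> f (Q ! ?j)"
      using sorted_nth_mono[OF Q(3), of i ?j] that j by auto
  qed
  have "(u, v) \<notin> reachable (E - ?F)" if "u \<in> ?B" "v \<in> ?B" "u \<noteq> v" for u v
  proof -
    obtain i l where il: "u = b i" "v = b l" "i \<le> ?j + 1" "l \<le> ?j + 1" using \<open>u \<in> ?B\<close> \<open>v \<in> ?B\<close> by auto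
    with \<open>u \<noteq> v\<close> consider "i < l" | "l < i" by (metis linorder_neqE_nat)
    then show ?thesis
    proof cases
      case 1
      then show ?thesis using sep[of i l] il by simp
    next
      case 2
      then show ?thesis using sep[of l i] il reachable_sym[of u v] by auto
    qed
  qed
  ultimately obtain e where e: "e \<in> ?F - C" "insert e C \<in> edge_indep V \<I> E"
    using edge_indep_augment[of E C ?F ?B] gh C by (auto simp: gomory_hu_tree_def)
  \<comment> \<open>The light edge \<open>e\<close> is a candidate in this step, so the greedy
    choice \<open>e'\<close> is no heavier.\<close>
  obtain e' where e': "e' \<in> E - C" "C' = insert e' C"
    "\<forall>e\<in>E - C. insert e C \<in> edge_indep V \<I> E \<longrightarrow> w e' \<le> w e"
    using step by (auto simp: gh_step_def)
  have "w e' \<le> w e" using e e'(3) by blast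
  also have "w e \<le> f (Q ! ?j)" using e(1) by blast
  finally show ?thesis using e'(1,2) by blast
qed

section \<open>Invariants of the greedy run\<close>

lemma gh_reaches_edge_indep:
  assumes "tree V E" "matroid_rank \<I> \<ge> 1" "gh_reaches V \<I> E w C"
  shows "C \<in> edge_indep V \<I> E \<and> card C \<le> matroid_rank \<I> - 1"
  using assms(3) unfolding gh_reaches_def
proof (induction rule: rtranclp_induct)
  case base
  then show ?case using empty_edge_indep[OF assms(1,2)] by simp
next
  case (step C C')
  then show ?case by (auto simp: gh_step_def intro: order_trans[OF card_insert_le_m1])
qed

text \<open>Each chosen edge is charged to the part whose index is the number of edges chosen before
  it, so no part is charged twice.\<close>

lemma gh_reaches_weight_le:
  assumes gh: "gomory_hu_tree V f E w" and rank: "matroid_rank \<I> \<ge> 1"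
    and reach: "gh_reaches V \<I> E w C"
    and Q: "partition_on V (set Q)" "distinct Q" "sorted (map f Q)" "length Q = matroid_rank \<I>"
    and B: "B \<in> bases \<I>" "\<And>X. X \<in> set Q \<Longrightarrow> card (B \<inter> X) = 1"
  shows "(\<Sum>e\<in>C. w e) \<le> (\<Sum>i<card C. f (Q ! i))"
  using reach unfolding gh_reaches_def
proof (induction rule: rtranclp_induct)
  case base
  then show ?case by simp
next
  case (step C C')
  have tree: "tree V E" using gh by (simp add: gomory_hu_tree_def)
  have C: "C \<in> edge_indep V \<I> E"
    using gh_reaches_edge_indep[OF tree rank] step.hyps(1) by (auto simp: gh_reaches_def)
  then have "finite C"
    using simple_graph_finite[OF _ finite_ground] tree
    by (auto simp: edge_indep_def tree_def intro: finite_subset)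
  moreover obtain e where "e \<in> E - C" "C' = insert e C" "w e \<le> f (Q ! card C)"
    using gh_step_weight_le[OF gh step.hyps(2) C Q B] by blast
  ultimately show ?case using step.IH by simp
qed

lemma components_feasible:
  assumes "tree V E" "C \<in> edge_indep V \<I> E" "card C + 1 = matroid_rank \<I>"
  shows "feasible V \<I> (components V (E - C))"
proof -
  let ?P = "components V (E - C)"
  obtain T where T: "T \<in> \<I>" "transversal ?P T" and CE: "C \<subseteq> E"
    using assms(2) by (auto simp: edge_indep_iff)
  have card: "card ?P = matroid_rank \<I>"
    using card_components_tree[OF assms(1) finite_ground CE] assms(3) by simp
  have "T \<in> bases \<I>"
    using T card transversal_card[OF components_partition_on T(2)] by (simp add: base_iff_card)
  moreover have "\<forall>X\<in>?P. card (T \<inter> X) = 1"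
    using T(2) by (auto simp: transversal_def card_1_singleton_iff)
  ultimately show ?thesis
    using card components_partition_on unfolding feasible_def by blast
qed

text \<open>The minimum ranges over a finite set, and the given feasible \<open>P\<close> makes it
  nonempty; in the final proof \<open>P\<close> is the output of the algorithm itself.\<close>

lemma opt_value_attained:
  assumes "feasible V \<I> P"
  shows "\<exists>Q. feasible V \<I> Q \<and> opt_value V f \<I> = (\<Sum>X\<in>Q. f X)"
proof -
  have "{P. feasible V \<I> P} \<subseteq> Pow (Pow V)"
    by (auto simp: feasible_def partition_on_def)
  then have "finite {P. feasible V \<I> P}" using finite_ground finite_subset by blast
  moreover have "{(\<Sum>X\<in>P. f X) | P. feasible V \<I> P} = sum f ` {P. feasible V \<I> P}" by auto
  ultimately have "opt_value V f \<I> \<in> sum f ` {P. feasible V \<I> P}"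
    unfolding opt_value_def using assms by (auto intro!: Min_in)
  then show ?thesis by auto
qed

end

text \<open>The omitted last term is a maximum and hence at least the average.\<close>

lemma sum_but_max_le:
  fixes g :: "nat \<Rightarrow> real"
  assumes "k \<ge> 1" "\<And>i. i < k \<Longrightarrow> g i \<le> g (k - 1)"
  shows "(\<Sum>i<k - 1. g i) \<le> (1 - 1 / real k) * (\<Sum>i<k. g i)"
proof -
  have "(\<Sum>i<k. g i) \<le> (\<Sum>i<k. g (k - 1))" using assms(2) by (intro sum_mono) auto
  then have "(\<Sum>i<k. g i) / real k \<le> g (k - 1)" using assms(1) by (simp add: field_simps)
  moreover have "(\<Sum>i<k. g i) = (\<Sum>i<k - 1. g i) + g (k - 1)"
    using assms(1) by (cases k) auto
  ultimately show ?thesis by (simp only: left_diff_distrib) simp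
qed

text \<open>\<open>gh_returns\<close> speaks only of runs that reach the exit condition; the first
  conjunct adds that a run can always be continued until then, so the claim about the output is not
  vacuous.\<close>

theorem theorem1:
  fixes V :: "'a set" and f :: "'a set \<Rightarrow> real" and \<I> :: "'a set set" and k :: nat
    and E :: "'a set set" and w :: "'a set \<Rightarrow> real"
  assumes "finite V"
    and "\<And>A. A \<subseteq> V \<Longrightarrow> f A \<ge> 0"
    and "submodular_on V f" and "symmetric_on V f" and "f {} = 0"
    and "matroid V \<I>" and "matroid_rank \<I> = k" and "k \<ge> 1"
    and "gomory_hu_tree V f E w"
  shows "(\<forall>C. gh_reaches V \<I> E w C \<and> card C < k - 1 \<longrightarrow> (\<exists>C'. gh_step V \<I> E w C C')) \<and>
    (\<forall>P. gh_returns V \<I> E w P \<longrightarrow>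
      feasible V \<I> P \<and> (\<Sum>X\<in>P. f X) \<le> (2 - 2 / real k) * opt_value V f \<I>)"
proof -
  interpret matroid V \<I> by fact
  have tree: "tree V E" using assms(9) by (simp add: gomory_hu_tree_def)
  have rank: "matroid_rank \<I> \<ge> 1" using assms(7,8) by simp
  note indep = gh_reaches_edge_indep[OF tree rank]
  have "feasible V \<I> P \<and> (\<Sum>X\<in>P. f X) \<le> (2 - 2 / real k) * opt_value V f \<I>"
    if P: "gh_returns V \<I> E w P" for P
  proof -
    obtain C where C: "gh_reaches V \<I> E w C" "\<not> card C < k - 1" "P = components V (E - C)"
      using P assms(7) by (auto simp: gh_returns_def)
    \<comment> \<open>The exit condition gives one inequality, the invariant the other.\<close>
    then have card: "card C = k - 1" using indep[OF C(1)] assms(7) by simp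
    have feas: "feasible V \<I> P"
      using components_feasible[OF tree] indep[OF C(1)] card assms(7,8) C(3) by simp
    then obtain Q where Q: "feasible V \<I> Q" "opt_value V f \<I> = (\<Sum>X\<in>Q. f X)"
      using opt_value_attained by blast
    have Q': "partition_on V Q" "card Q = k" using Q(1) assms(7) by (auto simp: feasible_def)
    obtain B where B: "B \<in> bases \<I>" "\<And>X. X \<in> Q \<Longrightarrow> card (B \<inter> X) = 1"
      using Q(1) by (auto simp: feasible_def)
    have "finite Q" using Q'(2) assms(8) by (auto intro: card_ge_0_finite)
    then obtain xs where xs: "set xs = Q" "distinct xs" using finite_distinct_list by blast
    \<comment> \<open>The parts of an optimal partition, listed by increasing value of
      \<open>f\<close>; the most expensive one comes last, at index \<open>k - 1\<close>.\<close>
    define q where "q = sort_key f xs"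
    have q: "set q = Q" "distinct q" "sorted (map f q)" "length q = k"
      using xs distinct_card[OF xs(2)] Q'(2) by (auto simp: q_def)
    have "(\<Sum>X\<in>P. f X) \<le> 2 * (\<Sum>e\<in>C. w e)"
      using sum_components_le[OF assms(1,3,4,2,5,9)] indep[OF C(1)] C(3)
      by (auto simp: edge_indep_def)
    also have "(\<Sum>e\<in>C. w e) \<le> (\<Sum>i<k - 1. f (q ! i))"
      using gh_reaches_weight_le[OF assms(9) rank C(1), of q B] Q' q B assms(7) card by simp
    also have "\<dots> \<le> (1 - 1 / real k) * (\<Sum>i<k. f (q ! i))"
      using sorted_nth_mono[OF q(3)] q(4) assms(8) by (intro sum_but_max_le) auto
    also have "(\<Sum>i<k. f (q ! i)) = opt_value V f \<I>"
      using sum.reindex_bij_betw[OF bij_betw_nth[OF q(2)], of "{..<k}" Q f] q Q(2) by simp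
    finally show ?thesis using feas by (simp add: algebra_simps)
  qed
  then show ?thesis using gh_step_exists[OF tree] indep assms(7) by blast
qed

end
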